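(* Let $(\mathfrak g,[\,,],\langle\,,,\rangle)$ and $(\mathfrak h,[\,,]',\langle\,,,\rangle')$ be two Lie-Yamaguti algebras. Then a Lie-Yamaguti algebra $(E,[\,,]_E,\langle\,,,\rangle_E)$ strongly factorizes through $\mathfrak g$ and $\mathfrak h$ if and only if there exists a matched pair of Lie-Yamaguti algebras $(\mathfrak g,\mathfrak h,(\rho,\mu),(\psi,\nu))$ (with the given Lie-Yamaguti structures on $\mathfrak g$ and $\mathfrak h$) such that $E\cong\mathfrak g\bowtie\mathfrak h$ as Lie-Yamaguti algebras.
   Context: All vector spaces and (multi)linear maps are over a field $\mathbf k$ of characteristic $0$. **Lie-Yamaguti algebra.** A vector space $\mathfrak g$ with linear maps $[\,,]:\wedge^2\mathfrak g\to\mathfrak g$ and $\langle\,,,\rangle:\wedge^2\mathfrak g\otimes\mathfrak g\to\mathfrak g$ such that for all $x,y,z,w,t\in\mathfrak g$: $[[x,y],z]+[[y,z],x]+[[z,x],y]+\langle x,y,z\rangle+\langle y,z,x\rangle+\langle z,x,y\rangle=0$; $\langle[x,y],z,w\rangle+\langle[y,z],x,w\rangle+\langle[z,x],y,w\rangle=0$; $\langle x,y,[z,w]\rangle=[\langle x,y,z\rangle,w]+[z,\langle x,y,w\rangle]$; $\langle x,y,\langle z,w,t\rangle\rangle=\langle\langle x,y,z\rangle,w,t\rangle+\langle z,\langle x,y,w\rangle,t\rangle+\langle z,w,\langle x,y,t\rangle\rangle$. Homomorphisms are linear maps preserving both operations; a subalgebra is a subspace closed under both operations. **Representation.** A representation $(V;\rho,\mu)$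 of $\mathfrak g$ is a vector space $V$ with linear maps $\rho:\mathfrak g\to\mathrm{End}(V)$, $x\mapsto\rho_x$, and $\mu:\mathfrak g\otimes\mathfrak g\to\mathrm{End}(V)$ such that, with $D_{\rho,\mu}(x,y):=\rho_x\rho_y-\rho_y\rho_x-\rho_{[x,y]}-\mu(x,y)+\mu(y,x)$, for all $x,y,z,w\in\mathfrak g$: $\mu([x,y],z)=\mu(x,z)\rho_y-\mu(y,z)\rho_x$; $\mu(x,[y,z])=\rho_y\mu(x,z)-\rho_z\mu(x,y)$; $\rho_{\langle x,y,z\rangle}=D_{\rho,\mu}(x,y)\rho_z-\rho_zD_{\rho,\mu}(x,y)$; $\mu(z,w)\mu(x,y)-\mu(y,w)\mu(x,z)-\mu(x,\langle y,z,w\rangle)+D_{\rho,\mu}(y,z)\mu(x,w)=0$; $\mu(\langle x,y,z\rangle,w)+\mu(z,\langle x,y,w\rangle)=D_{\rho,\mu}(x,y)\mu(z,w)-\mu(z,w)D_{\rho,\mu}(x,y)$. **Matched pair.** A matched pair of Lie-Yamaguti algebras $(\mathfrak g,\mathfrak h,(\rho,\mu),(\psi,\nu))$ consists of Lie-Yamaguti algebras $(\mathfrak g,[\,,],\langle\,,,\rangle)$, $(\mathfrak h,[\,,]',\langle\,,,\rangle')$ and linear maps $\rho:\mathfrak g\to\mathrm{End}(\mathfrak h)$, $\mu:\mathfrak g\otimes\mathfrak g\to\mathrm{End}(\mathfrak h)$, $\psi:\mathfrak h\to\mathrm{End}(\mathfrak g)$, $\nu:\mathfrak h\otimes\mathfrak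 h\to\mathrm{End}(\mathfrak g)$ such that $(\mathfrak h;\rho,\mu)$ is a representation of $\mathfrak g$, $(\mathfrak g;\psi,\nu)$ is a representation of $\mathfrak h$, and for all $x,y,z\in\mathfrak g$, $\alpha,\beta,\gamma\in\mathfrak h$: (1) $\rho_x([\alpha,\beta]')=[\rho_x\alpha,\beta]'+[\alpha,\rho_x\beta]'+\rho_{\psi_\beta x}\alpha-\rho_{\psi_\alpha x}\beta$; (2) $\rho_x(\langle\alpha,\beta,\gamma\rangle')=\langle\alpha,\beta,\rho_x\gamma\rangle'-\rho_{D_{\psi,\nu}(\alpha,\beta)x}\gamma$; (3) $\langle\rho_x\alpha,\beta,\gamma\rangle'+\langle\alpha,\rho_x\beta,\gamma\rangle'=0$; (4) $\rho_{\nu(\alpha,\beta)x}\gamma=\rho_{\nu(\alpha,\gamma)x}\beta$; (5) $\mu(x,y)([\alpha,\beta]')=\mu(\psi_\beta x,y)\alpha-\mu(\psi_\alpha x,y)\beta$; (6) $\mu(x,y)\langle\alpha,\beta,\gamma\rangle'=\langle\alpha,\beta,\mu(x,y)\gamma\rangle'-\mu(D_{\psi,\nu}(\alpha,\beta)x,y)\gamma-\mu(x,D_{\psi,\nu}(\alpha,\beta)y)\gamma$; (7) $\mu(x,\psi_\alpha y)\beta=[\alpha,\mu(x,y)\beta]'$; (8) $\mu(\nu(\alpha,\beta)x,y)\gamma-\mu(\nu(\alpha,\gamma)x,y)\beta=\mu(x,D_{\psi,\nu}(\beta,\gamma)y)\alpha-\langle\beta,\gamma,\mu(x,y)\alpha\rangle'$;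 (9) $\mu(x,\nu(\alpha,\beta)y)\gamma=\langle\mu(x,y)\gamma,\alpha,\beta\rangle'-D_{\rho,\mu}(y,\nu(\gamma,\alpha)x)\beta+\mu(y,\nu(\gamma,\beta)x)\alpha$; (10) $\psi_\alpha([x,y])=[\psi_\alpha x,y]+[x,\psi_\alpha y]+\psi_{\rho_y\alpha}x-\psi_{\rho_x\alpha}y$; (11) $\psi_\alpha(\langle x,y,z\rangle)=\langle x,y,\psi_\alpha z\rangle-\psi_{D_{\rho,\mu}(x,y)\alpha}z$; (12) $\langle\psi_\alpha x,y,z\rangle+\langle x,\psi_\alpha y,z\rangle=0$; (13) $\psi_{\mu(x,y)\alpha}z=\psi_{\mu(x,z)\alpha}y$; (14) $\nu(\alpha,\beta)([x,y])=\nu(\rho_y\alpha,\beta)x-\nu(\rho_x\alpha,\beta)y$; (15) $\nu(\alpha,\beta)\langle x,y,z\rangle=\langle x,y,\nu(\alpha,\beta)z\rangle-\nu(D_{\rho,\mu}(x,y)\alpha,\beta)z-\nu(\alpha,D_{\rho,\mu}(x,y)\beta)z$; (16) $\nu(\alpha,\rho_x\beta)y=[x,\nu(\alpha,\beta)y]$; (17) $\nu(\mu(x,y)\alpha,\beta)z-\nu(\mu(x,z)\alpha,\beta)y=\nu(\alpha,D_{\rho,\mu}(y,z)\beta)x-\langle y,z,\nu(\alpha,\beta)x\rangle$; (18) $\nu(\alpha,\mu(x,y)\beta)z=\langle\nu(\alpha,\beta)z,x,y\rangle-D_{\psi,\nu}(\beta,\mu(z,x)\alpha)y+\nu(\beta,\mu(z,y)\alpha)x$.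 **Bicrossed product.** $\mathfrak g\bowtie\mathfrak h$ is the Lie-Yamaguti algebra on $\mathfrak g\oplus\mathfrak h$ with operations $[(x,\alpha),(y,\beta)]_{\bowtie}=([x,y]+\psi_\alpha y-\psi_\beta x,\ [\alpha,\beta]'+\rho_x\beta-\rho_y\alpha)$, $\langle(x,\alpha),(y,\beta),(z,\gamma)\rangle_{\bowtie}=(\langle x,y,z\rangle+D_{\psi,\nu}(\alpha,\beta)z+\nu(\beta,\gamma)x-\nu(\alpha,\gamma)y,\ \langle\alpha,\beta,\gamma\rangle'+D_{\rho,\mu}(x,y)\gamma+\mu(y,z)\alpha-\mu(x,z)\beta)$. (It is known that this is a Lie-Yamaguti algebra.) **Strong factorization.** A Lie-Yamaguti algebra $(E,[\,,]_E,\langle\,,,\rangle_E)$ factorizes through $\mathfrak g$ and $\mathfrak h$ if (i) $E$ contains $\mathfrak g$ and $\mathfrak h$ as Lie-Yamaguti subalgebras (where $\mathfrak g$, $\mathfrak h$ are identified with their isomorphic copies in $E$, e.g. $\mathfrak g\cong\mathfrak g\oplus\{0\}$ and $\mathfrak h\cong\{0\}\oplus\mathfrak h$ in $\mathfrak g\bowtie\mathfrak h$), and (ii) $E=\mathfrak g+\mathfrak h$ and $\mathfrak g\cap\mathfrak h=\{0\}$. It strongly factorizes through $\mathfrak g$ and $\mathfrak h$ if additionally $\langle\mathfrak g,\mathfrak h,\mathfrak h\rangle_E\subset\mathfrak g$ and $\langle\mathfrak h,\mathfrak g,\mathfrak g\rangle_E\subset\mathfrak h$.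
   Formalization: Strong factorization is read as also requiring ⟨h,h,g⟩ ⊂ g and ⟨g,g,h⟩ ⊂ h; with only ⟨g,h,h⟩ ⊂ g and ⟨h,g,g⟩ ⊂ h the "only if" fails, e.g. [x,y]=u, [u,e]=c, ⟨x,y,e⟩=−c with g=span{x,y,u,c}, h=span{e}. *)

theory Defs
  imports "HOL-Analysis.Product_Vector"
begin

section \<open>Multilinear maps\<close>

definition bilinear_map ::
  "('k::field_char_0 \<Rightarrow> 'a::ab_group_add \<Rightarrow> 'a) \<Rightarrow> ('k \<Rightarrow> 'b::ab_group_add \<Rightarrow> 'b) \<Rightarrow>
   ('k \<Rightarrow> 'c::ab_group_add \<Rightarrow> 'c) \<Rightarrow> ('a \<Rightarrow> 'b \<Rightarrow> 'c) \<Rightarrow> bool"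
  where "bilinear_map s1 s2 s3 f \<longleftrightarrow>
    (\<forall>y. Vector_Spaces.linear s1 s3 (\<lambda>x. f x y)) \<and>
    (\<forall>x. Vector_Spaces.linear s2 s3 (\<lambda>y. f x y))"

definition trilinear_map ::
  "('k::field_char_0 \<Rightarrow> 'a::ab_group_add \<Rightarrow> 'a) \<Rightarrow> ('k \<Rightarrow> 'b::ab_group_add \<Rightarrow> 'b) \<Rightarrow>
   ('k \<Rightarrow> 'c::ab_group_add \<Rightarrow> 'c) \<Rightarrow> ('k \<Rightarrow> 'd::ab_group_add \<Rightarrow> 'd) \<Rightarrow>
   ('a \<Rightarrow> 'b \<Rightarrow> 'c \<Rightarrow> 'd) \<Rightarrow> bool"
  where "trilinear_map s1 s2 s3 s4 f \<longleftrightarrow>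
    (\<forall>y z. Vector_Spaces.linear s1 s4 (\<lambda>x. f x y z)) \<and>
    (\<forall>x z. Vector_Spaces.linear s2 s4 (\<lambda>y. f x y z)) \<and>
    (\<forall>x y. Vector_Spaces.linear s3 s4 (\<lambda>z. f x y z))"

section \<open>Lie-Yamaguti algebras\<close>

text \<open>The vector space is the whole type \<open>'v\<close>, with scalar multiplication \<open>scale\<close>.
  A linear map on an exterior square is rendered as a bilinear map that vanishes on the diagonal.\<close>

locale lie_yamaguti = vector_space scale
  for scale :: "'k::field_char_0 \<Rightarrow> 'v::ab_group_add \<Rightarrow> 'v" +
  fixes br :: "'v \<Rightarrow> 'v \<Rightarrow> 'v"
    and tr :: "'v \<Rightarrow> 'v \<Rightarrow> 'v \<Rightarrow> 'v"
  assumes br_bilinear: "bilinear_map scale scale scale br"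
    and br_alternating: "br x x = 0"
    and tr_trilinear: "trilinear_map scale scale scale scale tr"
    and tr_alternating: "tr x x z = 0"
    and LY1: "br (br x y) z + br (br y z) x + br (br z x) y
              + tr x y z + tr y z x + tr z x y = 0"
    and LY2: "tr (br x y) z w + tr (br y z) x w + tr (br z x) y w = 0"
    and LY3: "tr x y (br z w) = br (tr x y z) w + br z (tr x y w)"
    and LY4: "tr x y (tr z w t) = tr (tr x y z) w t + tr z (tr x y w) t + tr z w (tr x y t)"

definition ly_hom ::
  "('k::field_char_0 \<Rightarrow> 'a::ab_group_add \<Rightarrow> 'a) \<Rightarrow> ('a \<Rightarrow> 'a \<Rightarrow> 'a) \<Rightarrow> ('a \<Rightarrow> 'a \<Rightarrow> 'a \<Rightarrow> 'a) \<Rightarrow>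
   ('k \<Rightarrow> 'b::ab_group_add \<Rightarrow> 'b) \<Rightarrow> ('b \<Rightarrow> 'b \<Rightarrow> 'b) \<Rightarrow> ('b \<Rightarrow> 'b \<Rightarrow> 'b \<Rightarrow> 'b) \<Rightarrow>
   ('a \<Rightarrow> 'b) \<Rightarrow> bool"
  where "ly_hom sa bra tra sb brb trb f \<longleftrightarrow>
    Vector_Spaces.linear sa sb f \<and>
    (\<forall>x y. f (bra x y) = brb (f x) (f y)) \<and>
    (\<forall>x y z. f (tra x y z) = trb (f x) (f y) (f z))"

definition ly_isomorphic ::
  "('k::field_char_0 \<Rightarrow> 'a::ab_group_add \<Rightarrow> 'a) \<Rightarrow> ('a \<Rightarrow> 'a \<Rightarrow> 'a) \<Rightarrow> ('a \<Rightarrow> 'a \<Rightarrow> 'a \<Rightarrow> 'a) \<Rightarrow>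
   ('k \<Rightarrow> 'b::ab_group_add \<Rightarrow> 'b) \<Rightarrow> ('b \<Rightarrow> 'b \<Rightarrow> 'b) \<Rightarrow> ('b \<Rightarrow> 'b \<Rightarrow> 'b \<Rightarrow> 'b) \<Rightarrow> bool"
  where "ly_isomorphic sa bra tra sb brb trb \<longleftrightarrow>
    (\<exists>f. ly_hom sa bra tra sb brb trb f \<and> bij f)"

definition ly_subalgebra ::
  "('k::field_char_0 \<Rightarrow> 'v::ab_group_add \<Rightarrow> 'v) \<Rightarrow> ('v \<Rightarrow> 'v \<Rightarrow> 'v) \<Rightarrow> ('v \<Rightarrow> 'v \<Rightarrow> 'v \<Rightarrow> 'v) \<Rightarrow>
   'v set \<Rightarrow> bool"
  where "ly_subalgebra s br tr A \<longleftrightarrow>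
    module.subspace s A \<and>
    (\<forall>x\<in>A. \<forall>y\<in>A. br x y \<in> A) \<and>
    (\<forall>x\<in>A. \<forall>y\<in>A. \<forall>z\<in>A. tr x y z \<in> A)"

section \<open>Representations\<close>

definition rep_D ::
  "('g \<Rightarrow> 'g \<Rightarrow> 'g) \<Rightarrow> ('g \<Rightarrow> 'v \<Rightarrow> 'v::ab_group_add) \<Rightarrow> ('g \<Rightarrow> 'g \<Rightarrow> 'v \<Rightarrow> 'v) \<Rightarrow>
   'g \<Rightarrow> 'g \<Rightarrow> 'v \<Rightarrow> 'v"
  where "rep_D br \<rho> \<mu> x y v =
    \<rho> x (\<rho> y v) - \<rho> y (\<rho> x v) - \<rho> (br x y) v - \<mu> x y v + \<mu> y x v"

text \<open>Identities in \<open>End(V)\<close> are written out on an arbitrary vector \<open>v\<close>.\<close>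

locale ly_representation =
  lie_yamaguti sg br tr + V: vector_space sv
  for sg :: "'k::field_char_0 \<Rightarrow> 'g::ab_group_add \<Rightarrow> 'g"
    and br :: "'g \<Rightarrow> 'g \<Rightarrow> 'g"
    and tr :: "'g \<Rightarrow> 'g \<Rightarrow> 'g \<Rightarrow> 'g"
    and sv :: "'k \<Rightarrow> 'v::ab_group_add \<Rightarrow> 'v" +
  fixes \<rho> :: "'g \<Rightarrow> 'v \<Rightarrow> 'v"
    and \<mu> :: "'g \<Rightarrow> 'g \<Rightarrow> 'v \<Rightarrow> 'v"
  assumes rho_bilinear: "bilinear_map sg sv sv \<rho>"
    and mu_trilinear: "trilinear_map sg sg sv sv \<mu>"
    and rep1: "\<mu> (br x y) z v = \<mu> x z (\<rho> y v) - \<mu> y z (\<rho> x v)"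
    and rep2: "\<mu> x (br y z) v = \<rho> y (\<mu> x z v) - \<rho> z (\<mu> x y v)"
    and rep3: "\<rho> (tr x y z) v = rep_D br \<rho> \<mu> x y (\<rho> z v) - \<rho> z (rep_D br \<rho> \<mu> x y v)"
    and rep4: "\<mu> z w (\<mu> x y v) - \<mu> y w (\<mu> x z v) - \<mu> x (tr y z w) v
               + rep_D br \<rho> \<mu> y z (\<mu> x w v) = 0"
    and rep5: "\<mu> (tr x y z) w v + \<mu> z (tr x y w) v
               = rep_D br \<rho> \<mu> x y (\<mu> z w v) - \<mu> z w (rep_D br \<rho> \<mu> x y v)"

section \<open>Matched pairs and bicrossed products\<close>

locale ly_matched_pair =
  G: ly_representation sg brg trg sh \<rho> \<mu> +
  H: ly_representation sh brh trh sg \<psi> \<nu>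
  for sg :: "'k::field_char_0 \<Rightarrow> 'g::ab_group_add \<Rightarrow> 'g"
    and brg :: "'g \<Rightarrow> 'g \<Rightarrow> 'g"
    and trg :: "'g \<Rightarrow> 'g \<Rightarrow> 'g \<Rightarrow> 'g"
    and sh :: "'k \<Rightarrow> 'h::ab_group_add \<Rightarrow> 'h"
    and brh :: "'h \<Rightarrow> 'h \<Rightarrow> 'h"
    and trh :: "'h \<Rightarrow> 'h \<Rightarrow> 'h \<Rightarrow> 'h"
    and \<rho> :: "'g \<Rightarrow> 'h \<Rightarrow> 'h"
    and \<mu> :: "'g \<Rightarrow> 'g \<Rightarrow> 'h \<Rightarrow> 'h"
    and \<psi> :: "'h \<Rightarrow> 'g \<Rightarrow> 'g"
    and \<nu> :: "'h \<Rightarrow> 'h \<Rightarrow> 'g \<Rightarrow> 'g" +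
  assumes mp1: "\<rho> x (brh \<alpha> \<beta>)
      = brh (\<rho> x \<alpha>) \<beta> + brh \<alpha> (\<rho> x \<beta>) + \<rho> (\<psi> \<beta> x) \<alpha> - \<rho> (\<psi> \<alpha> x) \<beta>"
    and mp2: "\<rho> x (trh \<alpha> \<beta> \<gamma>) = trh \<alpha> \<beta> (\<rho> x \<gamma>) - \<rho> (rep_D brh \<psi> \<nu> \<alpha> \<beta> x) \<gamma>"
    and mp3: "trh (\<rho> x \<alpha>) \<beta> \<gamma> + trh \<alpha> (\<rho> x \<beta>) \<gamma> = 0"
    and mp4: "\<rho> (\<nu> \<alpha> \<beta> x) \<gamma> = \<rho> (\<nu> \<alpha> \<gamma> x) \<beta>"
    and mp5: "\<mu> x y (brh \<alpha> \<beta>) = \<mu> (\<psi> \<beta> x) y \<alpha> - \<mu> (\<psi> \<alpha> x) y \<beta>"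
    and mp6: "\<mu> x y (trh \<alpha> \<beta> \<gamma>)
      = trh \<alpha> \<beta> (\<mu> x y \<gamma>) - \<mu> (rep_D brh \<psi> \<nu> \<alpha> \<beta> x) y \<gamma> - \<mu> x (rep_D brh \<psi> \<nu> \<alpha> \<beta> y) \<gamma>"
    and mp7: "\<mu> x (\<psi> \<alpha> y) \<beta> = brh \<alpha> (\<mu> x y \<beta>)"
    and mp8: "\<mu> (\<nu> \<alpha> \<beta> x) y \<gamma> - \<mu> (\<nu> \<alpha> \<gamma> x) y \<beta>
      = \<mu> x (rep_D brh \<psi> \<nu> \<beta> \<gamma> y) \<alpha> - trh \<beta> \<gamma> (\<mu> x y \<alpha>)"
    and mp9: "\<mu> x (\<nu> \<alpha> \<beta> y) \<gamma>
      = trh (\<mu> x y \<gamma>) \<alpha> \<beta> - rep_D brg \<rho> \<mu> y (\<nu> \<gamma> \<alpha> x) \<beta> + \<mu> y (\<nu> \<gamma> \<beta> x) \<alpha>"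
    and mp10: "\<psi> \<alpha> (brg x y)
      = brg (\<psi> \<alpha> x) y + brg x (\<psi> \<alpha> y) + \<psi> (\<rho> y \<alpha>) x - \<psi> (\<rho> x \<alpha>) y"
    and mp11: "\<psi> \<alpha> (trg x y z) = trg x y (\<psi> \<alpha> z) - \<psi> (rep_D brg \<rho> \<mu> x y \<alpha>) z"
    and mp12: "trg (\<psi> \<alpha> x) y z + trg x (\<psi> \<alpha> y) z = 0"
    and mp13: "\<psi> (\<mu> x y \<alpha>) z = \<psi> (\<mu> x z \<alpha>) y"
    and mp14: "\<nu> \<alpha> \<beta> (brg x y) = \<nu> (\<rho> y \<alpha>) \<beta> x - \<nu> (\<rho> x \<alpha>) \<beta> y"
    and mp15: "\<nu> \<alpha> \<beta> (trg x y z)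
      = trg x y (\<nu> \<alpha> \<beta> z) - \<nu> (rep_D brg \<rho> \<mu> x y \<alpha>) \<beta> z - \<nu> \<alpha> (rep_D brg \<rho> \<mu> x y \<beta>) z"
    and mp16: "\<nu> \<alpha> (\<rho> x \<beta>) y = brg x (\<nu> \<alpha> \<beta> y)"
    and mp17: "\<nu> (\<mu> x y \<alpha>) \<beta> z - \<nu> (\<mu> x z \<alpha>) \<beta> y
      = \<nu> \<alpha> (rep_D brg \<rho> \<mu> y z \<beta>) x - trg y z (\<nu> \<alpha> \<beta> x)"
    and mp18: "\<nu> \<alpha> (\<mu> x y \<beta>) z
      = trg (\<nu> \<alpha> \<beta> z) x y - rep_D brh \<psi> \<nu> \<beta> (\<mu> z x \<alpha>) y + \<nu> \<beta> (\<mu> z y \<alpha>) x"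

text \<open>The underlying vector space of the bicrossed product is the product type with
  \<^const>\<open>module_prod.scale\<close>.\<close>

definition bicrossed_br ::
  "('g::ab_group_add \<Rightarrow> 'g \<Rightarrow> 'g) \<Rightarrow> ('h::ab_group_add \<Rightarrow> 'h \<Rightarrow> 'h) \<Rightarrow>
   ('g \<Rightarrow> 'h \<Rightarrow> 'h) \<Rightarrow> ('h \<Rightarrow> 'g \<Rightarrow> 'g) \<Rightarrow>
   'g \<times> 'h \<Rightarrow> 'g \<times> 'h \<Rightarrow> 'g \<times> 'h"
  where "bicrossed_br brg brh \<rho> \<psi> = (\<lambda>(x, \<alpha>) (y, \<beta>).
    (brg x y + \<psi> \<alpha> y - \<psi> \<beta> x, brh \<alpha> \<beta> + \<rho> x \<beta> - \<rho> y \<alpha>))"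

definition bicrossed_tr ::
  "('g::ab_group_add \<Rightarrow> 'g \<Rightarrow> 'g) \<Rightarrow> ('g \<Rightarrow> 'g \<Rightarrow> 'g \<Rightarrow> 'g) \<Rightarrow>
   ('h::ab_group_add \<Rightarrow> 'h \<Rightarrow> 'h) \<Rightarrow> ('h \<Rightarrow> 'h \<Rightarrow> 'h \<Rightarrow> 'h) \<Rightarrow>
   ('g \<Rightarrow> 'h \<Rightarrow> 'h) \<Rightarrow> ('g \<Rightarrow> 'g \<Rightarrow> 'h \<Rightarrow> 'h) \<Rightarrow> ('h \<Rightarrow> 'g \<Rightarrow> 'g) \<Rightarrow> ('h \<Rightarrow> 'h \<Rightarrow> 'g \<Rightarrow> 'g) \<Rightarrow>
   'g \<times> 'h \<Rightarrow> 'g \<times> 'h \<Rightarrow> 'g \<times> 'h \<Rightarrow> 'g \<times> 'h"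
  where "bicrossed_tr brg trg brh trh \<rho> \<mu> \<psi> \<nu> = (\<lambda>(x, \<alpha>) (y, \<beta>) (z, \<gamma>).
    (trg x y z + rep_D brh \<psi> \<nu> \<alpha> \<beta> z + \<nu> \<beta> \<gamma> x - \<nu> \<alpha> \<gamma> y,
     trh \<alpha> \<beta> \<gamma> + rep_D brg \<rho> \<mu> x y \<gamma> + \<mu> y z \<alpha> - \<mu> x z \<beta>))"

section \<open>Strong factorization\<close>

text \<open>\<open>A\<close> and \<open>B\<close> are the copies of the two factors inside \<open>E\<close>.\<close>

definition ly_factorization ::
  "('k::field_char_0 \<Rightarrow> 'e::ab_group_add \<Rightarrow> 'e) \<Rightarrow> ('e \<Rightarrow> 'e \<Rightarrow> 'e) \<Rightarrow> ('e \<Rightarrow> 'e \<Rightarrow> 'e \<Rightarrow> 'e) \<Rightarrow>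
   'e set \<Rightarrow> 'e set \<Rightarrow> bool"
  where "ly_factorization s br tr A B \<longleftrightarrow>
    ly_subalgebra s br tr A \<and> ly_subalgebra s br tr B \<and>
    {a + b | a b. a \<in> A \<and> b \<in> B} = UNIV \<and> A \<inter> B = {0}"

text \<open>The inclusion \<open>\<langle>A, B, B\<rangle> \<subset> A\<close> concerns all ternary products of one element of \<open>A\<close> and two
  elements of \<open>B\<close>, whatever the position of the element of \<open>A\<close>. Positions one and two are
  exchanged by skew-symmetry, but position three is not redundant, and the characterization by
  bicrossed products fails without it. For instance, on the span of \<open>x, y, u, c, e\<close> let
  \<open>[x,y] = u\<close>, \<open>[u,e] = c\<close>, \<open>\<langle>x,y,e\<rangle> = -c\<close>, with all other products of basis vectors that are
  not given by skew-symmetry being zero. For \<open>A = span{x,y,u,c}\<close> and \<open>B = span{e}\<close>, all products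
  in \<open>\<langle>A,B,B\<rangle>\<close> and \<open>\<langle>B,A,A\<rangle>\<close> with the factors in that order vanish, but \<open>\<langle>x,y,e\<rangle> \<notin> B\<close>, whereas
  \<open>\<langle>g,g,h\<rangle> \<subset> h\<close> holds in every bicrossed product.\<close>

definition mixed_tr_closed :: "('e \<Rightarrow> 'e \<Rightarrow> 'e \<Rightarrow> 'e) \<Rightarrow> 'e set \<Rightarrow> 'e set \<Rightarrow> bool"
  where "mixed_tr_closed tr A B \<longleftrightarrow>
    (\<forall>a\<in>A. \<forall>b\<in>B. \<forall>b'\<in>B. tr a b b' \<in> A \<and> tr b a b' \<in> A \<and> tr b b' a \<in> A)"

definition ly_strong_factorization ::
  "('k::field_char_0 \<Rightarrow> 'e::ab_group_add \<Rightarrow> 'e) \<Rightarrow> ('e \<Rightarrow> 'e \<Rightarrow> 'e) \<Rightarrow> ('e \<Rightarrow> 'e \<Rightarrow> 'e \<Rightarrow> 'e) \<Rightarrow>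
   'e set \<Rightarrow> 'e set \<Rightarrow> bool"
  where "ly_strong_factorization s br tr A B \<longleftrightarrow>
    ly_factorization s br tr A B \<and> mixed_tr_closed tr A B \<and> mixed_tr_closed tr B A"

definition strongly_factorizes_through ::
  "('k::field_char_0 \<Rightarrow> 'e::ab_group_add \<Rightarrow> 'e) \<Rightarrow> ('e \<Rightarrow> 'e \<Rightarrow> 'e) \<Rightarrow> ('e \<Rightarrow> 'e \<Rightarrow> 'e \<Rightarrow> 'e) \<Rightarrow>
   ('k \<Rightarrow> 'g::ab_group_add \<Rightarrow> 'g) \<Rightarrow> ('g \<Rightarrow> 'g \<Rightarrow> 'g) \<Rightarrow> ('g \<Rightarrow> 'g \<Rightarrow> 'g \<Rightarrow> 'g) \<Rightarrow>
   ('k \<Rightarrow> 'h::ab_group_add \<Rightarrow> 'h) \<Rightarrow> ('h \<Rightarrow> 'h \<Rightarrow> 'h) \<Rightarrow> ('h \<Rightarrow> 'h \<Rightarrow> 'h \<Rightarrow> 'h) \<Rightarrow> bool"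
  where "strongly_factorizes_through se bre tre sg brg trg sh brh trh \<longleftrightarrow>
    (\<exists>i j. ly_hom sg brg trg se bre tre i \<and> inj i \<and>
           ly_hom sh brh trh se bre tre j \<and> inj j \<and>
           ly_strong_factorization se bre tre (range i) (range j))"

end

theory Submission
  imports Defs
begin

text \<open>If \<open>E\<close> is the bicrossed product, the two coordinate subspaces are a strong factorization by
  inspection. Conversely, split every product of elements of \<open>E\<close> into its components in the
  two factors, and put \<open>\<rho>\<^sub>x \<alpha> = [x, \<alpha>]\<^sub>h\<close>, \<open>\<psi>\<^sub>\<alpha> x = [\<alpha>, x]\<^sub>g\<close>, \<open>\<mu>(x, y) \<alpha> = \<langle>\<alpha>, x, y\<rangle>\<close>,
  \<open>\<nu>(\<alpha>, \<beta>) x = \<langle>x, \<alpha>, \<beta>\<rangle>\<close>. The first Lie-Yamaguti identity forces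
  \<open>\<langle>x, y, \<alpha>\<rangle> = D(x, y) \<alpha>\<close>, and each axiom of a matched pair is the component in one factor of one
  of the Lie-Yamaguti identities on mixed arguments. Since the situation is symmetric in the two
  factors, only half of the axioms need to be checked.\<close>

section \<open>Linear maps and skew-symmetry of the two products\<close>

lemma linearD:
  assumes "Vector_Spaces.linear s1 s2 f"
  shows "f (x + y) = f x + f y" "f (x - y) = f x - f y" "f (- x) = - f x" "f 0 = 0"
    "f (s1 c x) = s2 c (f x)"
proof -
  interpret module_hom s1 s2 f
    using assms by (simp add: module_hom_iff_linear)
  show "f (x + y) = f x + f y" "f (x - y) = f x - f y" "f (- x) = - f x" "f 0 = 0"
    "f (s1 c x) = s2 c (f x)"
    by (fact add diff neg zero scale)+
qed

context lie_yamaguti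
begin

lemma br_linear:
  "Vector_Spaces.linear scale scale (\<lambda>x. br x y)" "Vector_Spaces.linear scale scale (br x)"
  using br_bilinear unfolding bilinear_map_def by auto

lemma tr_linear:
  "Vector_Spaces.linear scale scale (\<lambda>x. tr x y z)"
  "Vector_Spaces.linear scale scale (\<lambda>y. tr x y z)"
  "Vector_Spaces.linear scale scale (tr x y)"
  using tr_trilinear unfolding trilinear_map_def by auto

lemmas br_simps = linearD[OF br_linear(1)] linearD[OF br_linear(2)]
lemmas tr_simps = linearD[OF tr_linear(1)] linearD[OF tr_linear(2)] linearD[OF tr_linear(3)]

lemma br_skew: "br y x = - br x y"
proof -
  have "br (x + y) (x + y) = br x x + br y y + br x y + br y x"
    by (simp add: br_simps algebra_simps)
  then have "br x y + br y x = 0"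
    by (simp add: br_alternating)
  then show ?thesis
    by (simp add: eq_neg_iff_add_eq_0 add.commute)
qed

lemma tr_skew: "tr y x z = - tr x y z"
proof -
  have "tr (x + y) (x + y) z = tr x x z + tr y y z + tr x y z + tr y x z"
    by (simp add: tr_simps algebra_simps)
  then have "tr x y z + tr y x z = 0"
    by (simp add: tr_alternating)
  then show ?thesis
    by (simp add: eq_neg_iff_add_eq_0 add.commute)
qed

end

section \<open>Components of products in a strongly factorized algebra\<close>

locale ly_split =
  G: lie_yamaguti sg brg trg + H: lie_yamaguti sh brh trh + E: lie_yamaguti se bre tre
  for sg :: "'k::field_char_0 \<Rightarrow> 'g::ab_group_add \<Rightarrow> 'g"
    and brg :: "'g \<Rightarrow> 'g \<Rightarrow> 'g" and trg :: "'g \<Rightarrow> 'g \<Rightarrow> 'g \<Rightarrow> 'g"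
    and sh :: "'k \<Rightarrow> 'h::ab_group_add \<Rightarrow> 'h"
    and brh :: "'h \<Rightarrow> 'h \<Rightarrow> 'h" and trh :: "'h \<Rightarrow> 'h \<Rightarrow> 'h \<Rightarrow> 'h"
    and se :: "'k \<Rightarrow> 'e::ab_group_add \<Rightarrow> 'e"
    and bre :: "'e \<Rightarrow> 'e \<Rightarrow> 'e" and tre :: "'e \<Rightarrow> 'e \<Rightarrow> 'e \<Rightarrow> 'e" +
  fixes i :: "'g \<Rightarrow> 'e" and j :: "'h \<Rightarrow> 'e" and p :: "'e \<Rightarrow> 'g" and q :: "'e \<Rightarrow> 'h"
  assumes i_hom: "ly_hom sg brg trg se bre tre i"
    and j_hom: "ly_hom sh brh trh se bre tre j"
    and p_linear: "Vector_Spaces.linear se sg p"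
    and q_linear: "Vector_Spaces.linear se sh q"
    and p_i: "p (i x) = x" and p_j: "p (j \<alpha>) = 0"
    and q_i: "q (i x) = 0" and q_j: "q (j \<alpha>) = \<alpha>"
    and split: "i (p e) + j (q e) = e"
    and closed_gh: "mixed_tr_closed tre (range i) (range j)"
    and closed_hg: "mixed_tr_closed tre (range j) (range i)"
begin

definition act :: "'g \<Rightarrow> 'h \<Rightarrow> 'h"
  where "act x \<alpha> = q (bre (i x) (j \<alpha>))"

definition act2 :: "'g \<Rightarrow> 'g \<Rightarrow> 'h \<Rightarrow> 'h"
  where "act2 x y \<alpha> = q (tre (j \<alpha>) (i x) (i y))"

text \<open>Inclusions and projections are parameters on an equal footing, so the setting survives
  exchanging the two factors. The exchange turns \<open>act\<close> into \<psi> =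
  \<open>swap.act\<close> and \<open>act2\<close> into \<nu> = \<open>swap.act2\<close>, and gives
  every later fact a mirror image.\<close>

sublocale swap: ly_split sh brh trh sg brg trg se bre tre j i q p
  by (intro ly_split.intro ly_split_axioms.intro G.lie_yamaguti_axioms H.lie_yamaguti_axioms
      E.lie_yamaguti_axioms i_hom j_hom p_linear q_linear p_i p_j q_i q_j closed_gh closed_hg)
    (simp add: split add.commute[of "j _"])

lemma i_linear: "Vector_Spaces.linear sg se i"
  using i_hom by (simp add: ly_hom_def)

lemmas i_simps = linearD[OF i_linear]
lemmas p_simps = linearD[OF p_linear]

lemma br_ii: "bre (i x) (i y) = i (brg x y)"
  and tr_iii: "tre (i x) (i y) (i z) = i (trg x y z)"
  using i_hom by (simp_all add: ly_hom_def)

end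

(* Lemmas reach the sublocale swap only when the locale is reopened. *)
context ly_split
begin

text \<open>The minus signs come from skew-symmetry: \<open>swap.act \<alpha> x\<close> is a
  component of the bracket with its arguments in the other order.\<close>

lemma br_ij: "bre (i x) (j \<alpha>) = j (act x \<alpha>) - i (swap.act \<alpha> x)"
  and br_ji: "bre (j \<alpha>) (i x) = i (swap.act \<alpha> x) - j (act x \<alpha>)"
proof -
  have "i (p (bre (i x) (j \<alpha>))) = - i (swap.act \<alpha> x)"
    unfolding swap.act_def by (subst E.br_skew) (simp add: i_simps p_simps)
  then show "bre (i x) (j \<alpha>) = j (act x \<alpha>) - i (swap.act \<alpha> x)"
    using split[of "bre (i x) (j \<alpha>)"] by (simp add: act_def algebra_simps)
  then show "bre (j \<alpha>) (i x) = i (swap.act \<alpha> x) - j (act x \<alpha>)"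
    by (subst E.br_skew) simp
qed

text \<open>Strong factorization puts this product into the second copy, so the component taken in
  \<open>act2\<close> loses nothing.\<close>

lemma tr_jii: "tre (j \<alpha>) (i x) (i y) = j (act2 x y \<alpha>)"
proof -
  have "tre (j \<alpha>) (i x) (i y) \<in> range j"
    using closed_hg by (auto simp: mixed_tr_closed_def)
  then show ?thesis
    by (auto simp: act2_def q_j)
qed

lemma tr_iji: "tre (i x) (j \<alpha>) (i y) = - j (act2 x y \<alpha>)"
  by (subst E.tr_skew) (simp add: tr_jii)

end

context ly_split
begin

text \<open>Closure with the odd argument in third position leaves only a second component. The
  identity \<open>E.LY1\<close> on x, y, \<alpha> contains this product once; solving its second
  component for it gives \<open>rep_D\<close>.\<close>

lemma tr_iij: "tre (i x) (i y) (j \<alpha>) = j (rep_D brg act act2 x y \<alpha>)"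
proof -
  have "tre (i x) (i y) (j \<alpha>) \<in> range j"
    using closed_hg by (auto simp: mixed_tr_closed_def)
  then obtain \<beta> where \<beta>: "tre (i x) (i y) (j \<alpha>) = j \<beta>"
    by auto
  have "\<beta> = rep_D brg act act2 x y \<alpha>"
    using arg_cong[OF E.LY1[of "i x" "i y" "j \<alpha>"], of q]
    by (simp add: \<beta> br_ii br_ij br_ji tr_iji tr_jii E.br_simps swap.p_simps q_i q_j swap.br_ii
        rep_D_def algebra_simps eq_neg_iff_add_eq_0)
  with \<beta> show ?thesis by simp
qed

end

section \<open>Matched pair axioms as components of Lie-Yamaguti identities\<close>

context ly_split
begin

text \<open>These rules cover all four brackets and all eight ternary products of elements of the
  two copies; with multilinearity they expand any nested product. \<open>component_simps\<close>
  then reads off the second component.\<close>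

lemmas product_simps =
  br_ii br_ij br_ji tr_iii tr_jii tr_iji tr_iij
  swap.br_ii swap.tr_iii swap.tr_jii swap.tr_iji swap.tr_iij
  E.br_simps E.tr_simps
lemmas component_simps = swap.p_simps q_i q_j

lemma act_bilinear: "bilinear_map sg sh sh act"
  unfolding bilinear_map_def Vector_Spaces.linear_iff act_def
  using G.vector_space_axioms H.vector_space_axioms
  by (simp add: i_simps swap.i_simps swap.p_simps E.br_simps)

lemma act2_trilinear: "trilinear_map sg sg sh sh act2"
  unfolding trilinear_map_def Vector_Spaces.linear_iff act2_def
  using G.vector_space_axioms H.vector_space_axioms
  by (simp add: i_simps swap.i_simps swap.p_simps E.tr_simps)

text \<open>Each axiom is the second component of \<open>E.LY2\<close>, \<open>E.LY3\<close> or
  \<open>E.LY4\<close> with exactly one argument from the second factor; the place of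
  \<open>j v\<close> decides which axiom results.\<close>

lemma representation: "ly_representation sg brg trg sh act act2"
proof unfold_locales
  fix x y z w v
  show "act2 (brg x y) z v = act2 x z (act y v) - act2 y z (act x v)"
    using arg_cong[OF E.LY2[of "i x" "i y" "j v" "i z"], of q]
    by (simp add: product_simps component_simps algebra_simps)
  show "act2 x (brg y z) v = act y (act2 x z v) - act z (act2 x y v)"
    using arg_cong[OF E.LY3[of "j v" "i x" "i y" "i z"], of q]
    by (simp add: product_simps component_simps algebra_simps)
  show "act (trg x y z) v
      = rep_D brg act act2 x y (act z v) - act z (rep_D brg act act2 x y v)"
    using arg_cong[OF E.LY3[of "i x" "i y" "i z" "j v"], of q]
    by (simp add: product_simps component_simps algebra_simps)
  show "act2 z w (act2 x y v) - act2 y w (act2 x z v) - act2 x (trg y z w) v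
      + rep_D brg act act2 y z (act2 x w v) = 0"
    using arg_cong[OF E.LY4[of "j v" "i x" "i y" "i z" "i w"], of q]
    by (simp add: product_simps component_simps algebra_simps)
  show "act2 (trg x y z) w v + act2 z (trg x y w) v
      = rep_D brg act act2 x y (act2 z w v) - act2 z w (rep_D brg act act2 x y v)"
    using arg_cong[OF E.LY4[of "i x" "i y" "j v" "i z" "i w"], of q]
    by (simp add: product_simps component_simps algebra_simps)
qed (fact act_bilinear act2_trilinear)+

text \<open>From here to \<open>mp9\<close>, two or three arguments of an identity come from the
  second factor, and its second component is taken. Here the ternary terms all lie in the first copy
  and drop out.\<close>

lemma mp1: "act x (brh \<alpha> \<beta>) = brh (act x \<alpha>) \<beta> + brh \<alpha> (act x \<beta>)
    + act (swap.act \<beta> x) \<alpha> - act (swap.act \<alpha> x) \<beta>"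
  using arg_cong[OF E.LY1[of "i x" "j \<alpha>" "j \<beta>"], of q] H.br_skew[of "act x \<beta>" \<alpha>]
  by (simp add: product_simps component_simps algebra_simps)

lemma mp2: "act x (trh \<alpha> \<beta> \<gamma>) = trh \<alpha> \<beta> (act x \<gamma>)
    - act (rep_D brh swap.act swap.act2 \<alpha> \<beta> x) \<gamma>"
  using arg_cong[OF E.LY3[of "j \<alpha>" "j \<beta>" "i x" "j \<gamma>"], of q]
  by (simp add: product_simps component_simps algebra_simps)

lemma mp3: "trh (act x \<alpha>) \<beta> \<gamma> + trh \<alpha> (act x \<beta>) \<gamma> = 0"
  using arg_cong[OF E.LY2[of "i x" "j \<alpha>" "j \<beta>" "j \<gamma>"], of q] H.tr_skew[of "act x \<beta>" \<alpha> \<gamma>]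
  by (simp add: product_simps component_simps algebra_simps)

text \<open>The left side of \<open>E.LY3\<close> lies in the first copy here, so the second
  components of the two brackets on the right must cancel.\<close>

lemma mp4: "act (swap.act2 \<alpha> \<beta> x) \<gamma> = act (swap.act2 \<alpha> \<gamma> x) \<beta>"
  using arg_cong[OF E.LY3[of "i x" "j \<alpha>" "j \<beta>" "j \<gamma>"], of q]
  by (simp add: product_simps component_simps algebra_simps)

lemma mp5: "act2 x y (brh \<alpha> \<beta>) = act2 (swap.act \<beta> x) y \<alpha> - act2 (swap.act \<alpha> x) y \<beta>"
  using arg_cong[OF E.LY2[of "j \<alpha>" "j \<beta>" "i x" "i y"], of q]
  by (simp add: product_simps component_simps algebra_simps)

lemma mp6: "act2 x y (trh \<alpha> \<beta> \<gamma>) = trh \<alpha> \<beta> (act2 x y \<gamma>)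
    - act2 (rep_D brh swap.act swap.act2 \<alpha> \<beta> x) y \<gamma>
    - act2 x (rep_D brh swap.act swap.act2 \<alpha> \<beta> y) \<gamma>"
  using arg_cong[OF E.LY4[of "j \<alpha>" "j \<beta>" "j \<gamma>" "i x" "i y"], of q]
  by (simp add: product_simps component_simps algebra_simps)

lemma mp7: "act2 x (swap.act \<alpha> y) \<beta> = brh \<alpha> (act2 x y \<beta>)"
  using arg_cong[OF E.LY3[of "j \<beta>" "i x" "j \<alpha>" "i y"], of q]
  by (simp add: product_simps component_simps algebra_simps)

lemma mp8: "act2 (swap.act2 \<alpha> \<beta> x) y \<gamma> - act2 (swap.act2 \<alpha> \<gamma> x) y \<beta>
    = act2 x (rep_D brh swap.act swap.act2 \<beta> \<gamma> y) \<alpha> - trh \<beta> \<gamma> (act2 x y \<alpha>)"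
  using arg_cong[OF E.LY4[of "i x" "j \<alpha>" "j \<beta>" "j \<gamma>" "i y"], of q]
  by (simp add: product_simps component_simps algebra_simps)

text \<open>All four terms of this instance of \<open>E.LY4\<close> lie in the second copy, and they
  are the four terms of the claim.\<close>

lemma mp9: "act2 x (swap.act2 \<alpha> \<beta> y) \<gamma> = trh (act2 x y \<gamma>) \<alpha> \<beta>
    - rep_D brg act act2 y (swap.act2 \<gamma> \<alpha> x) \<beta> + act2 y (swap.act2 \<gamma> \<beta> x) \<alpha>"
  using arg_cong[OF E.LY4[of "j \<gamma>" "i x" "i y" "j \<alpha>" "j \<beta>"], of q]
  by (simp add: product_simps component_simps algebra_simps)

end

context ly_split
begin

text \<open>The conditions \<open>mp10\<close> to \<open>mp18\<close> of
  \<open>ly_matched_pair\<close> are \<open>mp1\<close> to \<open>mp9\<close> with the factors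
  exchanged, hence supplied by \<open>swap\<close>.\<close>

lemma matched_pair: "ly_matched_pair sg brg trg sh brh trh act act2 swap.act swap.act2"
  by (intro ly_matched_pair.intro ly_matched_pair_axioms.intro)
    (fact representation swap.representation mp1 mp2 mp3 mp4 mp5 mp6 mp7 mp8 mp9
      swap.mp1 swap.mp2 swap.mp3 swap.mp4 swap.mp5 swap.mp6 swap.mp7 swap.mp8 swap.mp9)+

lemma isomorphic_bicrossed:
  "ly_isomorphic se bre tre (module_prod.scale sg sh) (bicrossed_br brg brh act swap.act)
    (bicrossed_tr brg trg brh trh act act2 swap.act swap.act2)"
proof -
  interpret GH: vector_space_prod sg sh ..
  let ?f = "\<lambda>e. (p e, q e)"
  have "Vector_Spaces.linear se (module_prod.scale sg sh) ?f"
    using E.vector_space_axioms GH.p.vector_space_axioms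
    by (simp add: Vector_Spaces.linear_iff p_simps swap.p_simps GH.scale_prod)
  \<comment> \<open>Each argument is replaced by the sum of its components and the product of the
    sums is expanded, as in the ternary case below.\<close>
  moreover have "?f (bre e e') = bicrossed_br brg brh act swap.act (?f e) (?f e')" for e e'
    using arg_cong[OF arg_cong2[OF split[of e] split[of e'], of bre], of ?f]
    by (simp add: product_simps component_simps p_simps p_i p_j bicrossed_br_def algebra_simps)
  moreover have "?f (tre e e' e'') = bicrossed_tr brg trg brh trh act act2 swap.act swap.act2
      (?f e) (?f e') (?f e'')" for e e' e''
  proof -
    have "?f (tre e e' e'')
        = ?f (tre (i (p e) + j (q e)) (i (p e') + j (q e')) (i (p e'') + j (q e'')))"
      by (simp only: split)
    then show ?thesis
      by (simp add: product_simps component_simps p_simps p_i p_j bicrossed_tr_def algebra_simps)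
  qed
  moreover have "bij ?f"
  proof (rule bij_betw_byWitness)
    show "\<forall>e\<in>UNIV. (\<lambda>(x, \<alpha>). i x + j \<alpha>) (?f e) = e"
      by (simp add: split)
    show "\<forall>v\<in>UNIV. ?f ((\<lambda>(x, \<alpha>). i x + j \<alpha>) v) = v"
      by (auto simp: p_simps component_simps p_i p_j)
  qed auto
  ultimately show ?thesis
    unfolding ly_isomorphic_def ly_hom_def by blast
qed

end

section \<open>Projections from a strong factorization\<close>

lemma strongly_factorizes_imp_split:
  assumes "lie_yamaguti sg brg trg" "lie_yamaguti sh brh trh" "lie_yamaguti se bre tre"
    and "strongly_factorizes_through se bre tre sg brg trg sh brh trh"
  shows "\<exists>i j p q. ly_split sg brg trg sh brh trh se bre tre i j p q"
proof -
  obtain i j where i: "ly_hom sg brg trg se bre tre i" "inj i"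
    and j: "ly_hom sh brh trh se bre tre j" "inj j"
    and fac: "ly_strong_factorization se bre tre (range i) (range j)"
    using assms(4) unfolding strongly_factorizes_through_def by blast
  note lin = linearD[OF i(1)[unfolded ly_hom_def, THEN conjunct1]]
    linearD[OF j(1)[unfolded ly_hom_def, THEN conjunct1]]
  have sum: "{a + b | a b. a \<in> range i \<and> b \<in> range j} = UNIV"
    and int: "range i \<inter> range j = {0}"
    using fac unfolding ly_strong_factorization_def ly_factorization_def by auto
  \<comment> \<open>Two decompositions of one element differ by a vector in both copies, which is
    zero; injectivity then recovers the coordinates.\<close>
  have uniq: "x = y \<and> \<alpha> = \<beta>" if "i x + j \<alpha> = i y + j \<beta>" for x y \<alpha> \<beta>
  proof -
    have eq: "i (x - y) = j (\<beta> - \<alpha>)"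
      using that by (simp add: lin algebra_simps)
    then have "i (x - y) \<in> range i \<inter> range j"
      by (metis IntI rangeI)
    then have "i (x - y) = 0" "j (\<beta> - \<alpha>) = 0"
      using int eq by auto
    then show ?thesis
      using i(2) j(2) by (simp add: lin injD)
  qed
  have "\<exists>x \<alpha>. i x + j \<alpha> = e" for e
  proof -
    have "e \<in> {a + b | a b. a \<in> range i \<and> b \<in> range j}"
      by (simp only: sum UNIV_I)
    then show ?thesis by auto
  qed
  then obtain p q where pq: "i (p e) + j (q e) = e" for e
    by metis
  \<comment> \<open>Any exhibited decomposition computes \<open>p\<close> and \<open>q\<close>.
    Linearity and the values on both copies follow by exhibiting one, with the other component
    supplied explicitly.\<close>
  have p_eq: "p e = x" and q_eq: "q e = \<alpha>" if "e = i x + j \<alpha>" for e x \<alpha>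
    using uniq[of "p e" "q e" x \<alpha>] that by (simp_all add: pq)
  have "p (e + e') = p e + p e'" "q (e + e') = q e + q e'" for e e'
    by (rule p_eq[of _ _ "q e + q e'"] q_eq[of _ "p e + p e'"],
        use pq[of e] pq[of e'] in \<open>simp add: lin algebra_simps\<close>)+
  moreover have "p (se c e) = sg c (p e)" "q (se c e) = sh c (q e)" for c e
    using pq[of e] module.scale_right_distrib[of se c "i (p e)" "j (q e)"] assms(3)
    by (auto intro!: p_eq[of _ _ "sh c (q e)"] q_eq[of _ "sg c (p e)"]
        simp: lin lie_yamaguti_def module_iff_vector_space)
  ultimately have "Vector_Spaces.linear se sg p" "Vector_Spaces.linear se sh q"
    using assms(1-3) by (simp_all add: Vector_Spaces.linear_iff lie_yamaguti_def)
  moreover have "p (i x) = x" "q (i x) = 0" for x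
    by (rule p_eq[of _ _ 0] q_eq[of _ x], simp add: lin)+
  moreover have "p (j \<alpha>) = 0" "q (j \<alpha>) = \<alpha>" for \<alpha>
    by (rule p_eq[of _ _ \<alpha>] q_eq[of _ 0], simp add: lin)+
  ultimately have "ly_split sg brg trg sh brh trh se bre tre i j p q"
    using assms(1-3) i(1) j(1) pq fac
    by (intro ly_split.intro ly_split_axioms.intro) (simp_all add: ly_strong_factorization_def)
  then show ?thesis by blast
qed

section \<open>Strong factorization of a bicrossed product\<close>

lemma bicrossed_imp_strongly_factorizes:
  assumes "lie_yamaguti se bre tre"
    and "ly_matched_pair sg brg trg sh brh trh \<rho> \<mu> \<psi> \<nu>"
    and "ly_isomorphic se bre tre (module_prod.scale sg sh) (bicrossed_br brg brh \<rho> \<psi>)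
      (bicrossed_tr brg trg brh trh \<rho> \<mu> \<psi> \<nu>)"
  shows "strongly_factorizes_through se bre tre sg brg trg sh brh trh"
proof -
  interpret E: lie_yamaguti se bre tre by fact
  interpret M: ly_matched_pair sg brg trg sh brh trh \<rho> \<mu> \<psi> \<nu> by fact
  interpret GH: vector_space_prod sg sh ..
  obtain f where f: "ly_hom se bre tre (module_prod.scale sg sh) (bicrossed_br brg brh \<rho> \<psi>)
      (bicrossed_tr brg trg brh trh \<rho> \<mu> \<psi> \<nu>) f" and "bij f"
    using assms(3) unfolding ly_isomorphic_def by blast
  note lin = linearD[OF f[unfolded ly_hom_def, THEN conjunct1]]
  have f_br: "f (bre e e') = bicrossed_br brg brh \<rho> \<psi> (f e) (f e')"
    and f_tr: "f (tre e e' e'') = bicrossed_tr brg trg brh trh \<rho> \<mu> \<psi> \<nu> (f e) (f e') (f e'')"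
    for e e' e''
    using f unfolding ly_hom_def by auto
  note maps = M.G.rho_bilinear M.G.mu_trilinear M.H.rho_bilinear M.H.mu_trilinear
  \<comment> \<open>All structure maps vanish when some argument is zero; this removes the cross
    terms on the coordinate axes. The indices 4, 9, 14 pick the zero rule for each argument.\<close>
  note zero = linearD(4)[OF maps(1)[unfolded bilinear_map_def, THEN conjunct1, rule_format]]
    linearD(4)[OF maps(1)[unfolded bilinear_map_def, THEN conjunct2, rule_format]]
    linearD(4)[OF maps(3)[unfolded bilinear_map_def, THEN conjunct1, rule_format]]
    linearD(4)[OF maps(3)[unfolded bilinear_map_def, THEN conjunct2, rule_format]]
    linearD(4)[OF maps(2)[unfolded trilinear_map_def, THEN conjunct1, rule_format]]
    linearD(4)[OF maps(2)[unfolded trilinear_map_def, THEN conjunct2, THEN conjunct1, rule_format]]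
    linearD(4)[OF maps(2)[unfolded trilinear_map_def, THEN conjunct2, THEN conjunct2, rule_format]]
    linearD(4)[OF maps(4)[unfolded trilinear_map_def, THEN conjunct1, rule_format]]
    linearD(4)[OF maps(4)[unfolded trilinear_map_def, THEN conjunct2, THEN conjunct1, rule_format]]
    linearD(4)[OF maps(4)[unfolded trilinear_map_def, THEN conjunct2, THEN conjunct2, rule_format]]
    M.G.br_simps(4,9) M.H.br_simps(4,9) M.G.tr_simps(4,9,14) M.H.tr_simps(4,9,14)
  \<comment> \<open>The isomorphism leaves \<open>E\<close>, so the copies of the factors are the
    preimages of the coordinate axes.\<close>
  define i where "i x = inv f (x, 0)" for x
  define j where "j \<alpha> = inv f (0, \<alpha>)" for \<alpha>
  have f_i: "f (i x) = (x, 0)" and f_j: "f (j \<alpha>) = (0, \<alpha>)" for x \<alpha>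
    using \<open>bij f\<close> by (simp_all add: i_def j_def bij_is_surj surj_f_inv_f)
  \<comment> \<open>Equations in \<open>E\<close> are transported to the product, where they are
    compared by coordinates.\<close>
  have f_inj: "e = e' \<longleftrightarrow> f e = f e'" for e e'
    using \<open>bij f\<close> by (metis bij_is_inj injD)
  note f_simps = f_inj f_i f_j f_br f_tr lin bicrossed_br_def bicrossed_tr_def rep_D_def zero
  \<comment> \<open>Each copy is the zero set of one coordinate, so a closure claim reduces to
    computing that coordinate.\<close>
  have range_i: "e \<in> range i \<longleftrightarrow> snd (f e) = 0" for e
  proof
    assume "snd (f e) = 0"
    then have "e = i (fst (f e))"
      by (simp add: f_inj[of e] f_i prod_eq_iff)
    then show "e \<in> range i" by blast
  qed (auto simp: f_i)
  have range_j: "e \<in> range j \<longleftrightarrow> fst (f e) = 0" for e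
  proof
    assume "fst (f e) = 0"
    then have "e = j (snd (f e))"
      by (simp add: f_inj[of e] f_j prod_eq_iff)
    then show "e \<in> range j" by blast
  qed (auto simp: f_j)
  have i: "ly_hom sg brg trg se bre tre i" "inj i"
    using M.G.vector_space_axioms E.vector_space_axioms
    by (auto simp: ly_hom_def Vector_Spaces.linear_iff inj_def f_simps GH.scale_prod)
  have j: "ly_hom sh brh trh se bre tre j" "inj j"
    using M.G.V.vector_space_axioms E.vector_space_axioms
    by (auto simp: ly_hom_def Vector_Spaces.linear_iff inj_def f_simps GH.scale_prod)
  have "ly_subalgebra se bre tre (range i)"
    unfolding ly_subalgebra_def E.subspace_def
    by (auto simp: range_i f_i f_j f_br f_tr lin GH.scale_def bicrossed_br_def bicrossed_tr_def
        rep_D_def zero)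
  moreover have "ly_subalgebra se bre tre (range j)"
    unfolding ly_subalgebra_def E.subspace_def
    by (auto simp: range_j f_i f_j f_br f_tr lin GH.scale_def bicrossed_br_def bicrossed_tr_def
        rep_D_def zero)
  moreover have "{a + b | a b. a \<in> range i \<and> b \<in> range j} = UNIV"
  proof -
    have "e = i (fst (f e)) + j (snd (f e))" for e
      by (simp add: f_inj[of e] f_i f_j lin)
    then show ?thesis by blast
  qed
  moreover have "range i \<inter> range j = {0}"
  proof -
    have "e \<in> range i \<inter> range j \<longleftrightarrow> e = 0" for e
      unfolding Int_iff range_i range_j f_inj[of e 0] by (auto simp: lin(4) prod_eq_iff)
    then show ?thesis by blast
  qed
  \<comment> \<open>With two arguments from the second axis, each summand of the second coordinate
    has a zero argument.\<close>
  moreover have "mixed_tr_closed tre (range i) (range j)"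
    unfolding mixed_tr_closed_def
    by (auto simp: range_i f_i f_j f_tr bicrossed_tr_def rep_D_def zero)
  moreover have "mixed_tr_closed tre (range j) (range i)"
    unfolding mixed_tr_closed_def
    by (auto simp: range_j f_i f_j f_tr bicrossed_tr_def rep_D_def zero)
  ultimately show ?thesis
    unfolding strongly_factorizes_through_def ly_strong_factorization_def ly_factorization_def
    using i j by blast
qed

theorem theorem3p7:
  fixes sg :: "'k::field_char_0 \<Rightarrow> 'g::ab_group_add \<Rightarrow> 'g"
    and brg :: "'g \<Rightarrow> 'g \<Rightarrow> 'g" and trg :: "'g \<Rightarrow> 'g \<Rightarrow> 'g \<Rightarrow> 'g"
    and sh :: "'k \<Rightarrow> 'h::ab_group_add \<Rightarrow> 'h"
    and brh :: "'h \<Rightarrow> 'h \<Rightarrow> 'h" and trh :: "'h \<Rightarrow> 'h \<Rightarrow> 'h \<Rightarrow> 'h"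
    and se :: "'k \<Rightarrow> 'e::ab_group_add \<Rightarrow> 'e"
    and bre :: "'e \<Rightarrow> 'e \<Rightarrow> 'e" and tre :: "'e \<Rightarrow> 'e \<Rightarrow> 'e \<Rightarrow> 'e"
  assumes "lie_yamaguti sg brg trg"
    and "lie_yamaguti sh brh trh"
    and "lie_yamaguti se bre tre"
  shows "strongly_factorizes_through se bre tre sg brg trg sh brh trh \<longleftrightarrow>
    (\<exists>\<rho> \<mu> \<psi> \<nu>. ly_matched_pair sg brg trg sh brh trh \<rho> \<mu> \<psi> \<nu> \<and>
      ly_isomorphic se bre tre
        (module_prod.scale sg sh) (bicrossed_br brg brh \<rho> \<psi>)
        (bicrossed_tr brg trg brh trh \<rho> \<mu> \<psi> \<nu>))"
proof
  assume "strongly_factorizes_through se bre tre sg brg trg sh brh trh"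
  then obtain i j p q where "ly_split sg brg trg sh brh trh se bre tre i j p q"
    using strongly_factorizes_imp_split[OF assms] by blast
  then interpret ly_split sg brg trg sh brh trh se bre tre i j p q .
  show "\<exists>\<rho> \<mu> \<psi> \<nu>. ly_matched_pair sg brg trg sh brh trh \<rho> \<mu> \<psi> \<nu> \<and>
      ly_isomorphic se bre tre (module_prod.scale sg sh) (bicrossed_br brg brh \<rho> \<psi>)
        (bicrossed_tr brg trg brh trh \<rho> \<mu> \<psi> \<nu>)"
    using matched_pair isomorphic_bicrossed by blast
qed (use bicrossed_imp_strongly_factorizes assms(3) in blast)

end
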